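(* For any $p\in\mathcal P$, let $x$ be the best response that solves $$f(p)=\max_{x\in\mathcal X}\ -v(x)=\log(u(x))\quad\text{s.t. }\langle p,x\rangle\le w,\ Ax=0,$$ where $u$ is continuous and homogeneous of degree $d>0$. Then the dual variable to the budget constraint is $\lambda=\frac dw$. With $W=\nabla^2v(x)$, the gradient and Hessian of $f$ are $$\nabla f(p)=-\lambda x(p),\qquad\nabla^2f(p)=\frac{d^2}{w^2}\Big(W^{-1}-W^{-1}A^\top(AW^{-1}A^\top)^{-1}AW^{-1}\Big).$$
   Context: $\mathcal X=\mathbb R^n_+$ is the allocation cone, $\mathcal P\subseteq\mathbb R^n_+$ the set of prices (strictly positive), $w>0$ a budget, $A$ a real matrix with $n$ columns describing homogeneous linear constraints, $v=-\log u$. Standing assumption: $u$ is differentiable and strictly concave, and the best response $x(p)$ is unique. The inverses $W^{-1}$ and $(AW^{-1}A^\top)^{-1}$ in the formula are understood to exist.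
   Formalization: The Hessian formula is proved when the best response x(p) is interior to the orthant (it fails at boundary responses); existence of the dual variable is proved when Ax=0 has an interior solution, while any dual solution has λ=d/w. *)

theory Defs
  imports "HOL-Analysis.Analysis"
begin

definition orthant :: "(real ^ 'n) set" where
  "orthant = {x. \<forall>i. 0 \<le> x $ i}"

definition homogeneous_on :: "(real ^ 'n) set \<Rightarrow> real \<Rightarrow> (real ^ 'n \<Rightarrow> real) \<Rightarrow> bool" where
  "homogeneous_on S d u \<longleftrightarrow> (\<forall>x\<in>S. \<forall>t>0. u (t *\<^sub>R x) = t powr d * u x)"

definition strictly_concave_on :: "(real ^ 'n) set \<Rightarrow> (real ^ 'n \<Rightarrow> real) \<Rightarrow> bool" where
  "strictly_concave_on S u \<longleftrightarrow> convex S \<and>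
     (\<forall>x\<in>S. \<forall>y\<in>S. \<forall>t. x \<noteq> y \<longrightarrow> 0 < t \<longrightarrow> t < 1 \<longrightarrow>
        (1 - t) * u x + t * u y < u ((1 - t) *\<^sub>R x + t *\<^sub>R y))"

(* The Hessian matrix is the Jacobian matrix of the gradient; the gradient must exist on a
   neighbourhood of the point. *)
definition has_hessian :: "(real ^ 'n \<Rightarrow> real) \<Rightarrow> real ^ 'n ^ 'n \<Rightarrow> real ^ 'n \<Rightarrow> bool" where
  "has_hessian g H x \<longleftrightarrow>
     (\<exists>G. (\<forall>\<^sub>F y in nhds x. GDERIV g y :> G y) \<and> (G has_derivative (\<lambda>h. H *v h)) (at x))"

definition neg_log :: "(real ^ 'n \<Rightarrow> real) \<Rightarrow> real ^ 'n \<Rightarrow> real" where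
  "neg_log u x = - ln (u x)"

(* The set on which the objective log u is finite.  Points of the orthant with u = 0 have
   objective value - infinity and are left out, since ln is a total function into the reals. *)
definition log_domain :: "(real ^ 'n \<Rightarrow> real) \<Rightarrow> (real ^ 'n) set" where
  "log_domain u = {x \<in> orthant. 0 < u x}"

definition feasible :: "(real ^ 'n \<Rightarrow> real) \<Rightarrow> real ^ 'n ^ 'm \<Rightarrow> real \<Rightarrow> real ^ 'n \<Rightarrow> (real ^ 'n) set" where
  "feasible u A w p = {x \<in> log_domain u. p \<bullet> x \<le> w \<and> A *v x = 0}"

definition best_response ::
    "(real ^ 'n \<Rightarrow> real) \<Rightarrow> real ^ 'n ^ 'm \<Rightarrow> real \<Rightarrow> real ^ 'n \<Rightarrow> real ^ 'n \<Rightarrow> bool" where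
  "best_response u A w p x \<longleftrightarrow>
     is_arg_max (\<lambda>y. - neg_log u y) (\<lambda>y. y \<in> feasible u A w p) x"

definition value_fun :: "(real ^ 'n \<Rightarrow> real) \<Rightarrow> real ^ 'n ^ 'm \<Rightarrow> real \<Rightarrow> real ^ 'n \<Rightarrow> real" where
  "value_fun u A w p = (SUP x\<in>feasible u A w p. - neg_log u x)"

(* lam is the multiplier of the budget constraint, mu that of A x = 0; membership in the
   orthant is kept as a set constraint. *)
definition lagrangian ::
    "(real ^ 'n \<Rightarrow> real) \<Rightarrow> real ^ 'n ^ 'm \<Rightarrow> real \<Rightarrow> real ^ 'n \<Rightarrow> real ^ 'n \<Rightarrow> real \<Rightarrow> real ^ 'm \<Rightarrow> real" where
  "lagrangian u A w p x lam mu = - neg_log u x + lam * (w - p \<bullet> x) - mu \<bullet> (A *v x)"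

definition dual_fun ::
    "(real ^ 'n \<Rightarrow> real) \<Rightarrow> real ^ 'n ^ 'm \<Rightarrow> real \<Rightarrow> real ^ 'n \<Rightarrow> real \<Rightarrow> real ^ 'm \<Rightarrow> ereal" where
  "dual_fun u A w p lam mu = (SUP x\<in>log_domain u. ereal (lagrangian u A w p x lam mu))"

definition dual_optimal ::
    "(real ^ 'n \<Rightarrow> real) \<Rightarrow> real ^ 'n ^ 'm \<Rightarrow> real \<Rightarrow> real ^ 'n \<Rightarrow> real \<Rightarrow> real ^ 'm \<Rightarrow> bool" where
  "dual_optimal u A w p lam mu \<longleftrightarrow> 0 \<le> lam \<and>
     (\<forall>lam' mu'. 0 \<le> lam' \<longrightarrow> dual_fun u A w p lam mu \<le> dual_fun u A w p lam' mu')"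

end

theory Submission
  imports Defs
begin

text \<open>
  Homogeneity makes the budget constraint trivial: every bundle can be rescaled to the budget plane,
  so the value at price \<open>q\<close> is, up to a constant, the maximum of
  \<open>ln u - d ln (q \<bullet> _)\<close> over the admissible cone (\<open>best_response_ray\<close>). Bounding the
  logarithm by its tangent at the budget \<open>w\<close> produces the slope \<open>d / w\<close> and one affine
  inequality (\<open>best_response_lagrangian\<close>) on which everything else rests.

  The dual function also scales: multiplying both multipliers by \<open>s\<close> changes it by
  \<open>(s - 1) lam w - d ln s\<close>, and optimality at \<open>s = 1\<close> gives \<open>lam = d / w\<close>
  (\<open>dual_optimal_budget_multiplier\<close>). If some interior bundle satisfies the linear constraints,
  separating the hypograph of the penalised objective from the kernel of \<open>A\<close> yields the remaining
  multiplier (\<open>kernel_constraint_multiplier\<close>, \<open>dual_optimal_exists\<close>).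

  The affine inequality, used once at \<open>p\<close> and once at a nearby price \<open>q\<close>, squeezes the
  first-order remainder of the value function by \<open>(d / w) * norm (q - p)\<close> times the distance between
  the best responses, and that distance tends to \<open>0\<close> by compactness and uniqueness at \<open>p\<close>
  (\<open>best_responses_converge\<close>, \<open>gderiv_value_fun\<close>). Only prices near \<open>p\<close> matter here, and
  best responses there may fail to be unique.

  For the Hessian, nearby best responses \<open>X q\<close> are interior and therefore unique, and satisfy
  \<open>\<nabla>v (X q) + (d / w) q = transpose A *v \<mu>\<close> with \<open>A *v X q = 0\<close>, where \<open>v = - ln u\<close>. The
  matrix \<open>T\<close> in the Hessian formula kills the range of \<open>transpose A\<close> and inverts
  \<open>W\<close> on the kernel of \<open>A\<close>. Applying \<open>T\<close> therefore solves the linearised condition,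
  \<open>X q - X p \<approx> - (d / w) T (q - p)\<close>; the error is controlled with differentiability of the gradient
  at the single point \<open>x p\<close> only (\<open>has_derivative_implicit\<close>). Differentiating the gradient
  \<open>- (d / w) X q\<close> gives \<open>(d / w)\<^sup>2 T\<close>.
\<close>

section \<open>The orthant and budget sets\<close>

lemma interior_orthant: "interior (orthant :: (real ^ 'n) set) = {x. \<forall>i. 0 < x $ i}"
proof (rule interior_unique)
  show "{x. \<forall>i. 0 < x $ i} \<subseteq> (orthant :: (real ^ 'n) set)"
    by (auto simp: orthant_def less_imp_le)
  have "open (\<Inter>i. {x :: real ^ 'n. 0 < x $ i})"
    by (intro open_INT ballI finite open_Collect_less continuous_intros)
  then show "open {x :: real ^ 'n. \<forall>i. 0 < x $ i}"
    by (simp add: Collect_all_eq)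
  fix T :: "(real ^ 'n) set" assume T: "T \<subseteq> orthant" "open T"
  have "T \<subseteq> interior {x. 0 \<le> x $ i}" for i
    using T by (intro interior_maximal) (auto simp: orthant_def)
  then show "T \<subseteq> {x. \<forall>i. 0 < x $ i}" by force
qed

lemma closed_orthant: "closed (orthant :: (real ^ 'n) set)"
  unfolding orthant_def
  by (intro closed_Collect_all closed_Collect_le continuous_intros)

lemma convex_orthant: "convex (orthant :: (real ^ 'n) set)"
  by (auto simp: orthant_def convex_def)

lemma orthant_scaleR: "x \<in> orthant \<Longrightarrow> 0 \<le> t \<Longrightarrow> t *\<^sub>R x \<in> orthant"
  by (simp add: orthant_def)

lemma zero_in_orthant: "0 \<in> orthant"
  by (simp add: orthant_def)

lemma inner_le_of_price_le:
  fixes q r y :: "real ^ 'n"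
  assumes "y \<in> orthant" "\<And>i. q $ i \<le> r $ i"
  shows "q \<bullet> y \<le> r \<bullet> y"
  using assms by (auto simp: orthant_def inner_vec_def intro!: sum_mono mult_right_mono)

lemma component_le_inner:
  fixes q y :: "real ^ 'n"
  assumes "\<And>i. 0 < q $ i" "y \<in> orthant"
  shows "q $ i * y $ i \<le> q \<bullet> y"
proof -
  have "(\<Sum>j\<in>{i}. q $ j * y $ j) \<le> (\<Sum>j\<in>UNIV. q $ j * y $ j)"
    using assms by (intro sum_mono2) (auto simp: orthant_def less_imp_le)
  then show ?thesis by (simp add: inner_vec_def)
qed

lemma inner_pos:
  fixes q y :: "real ^ 'n"
  assumes "\<And>i. 0 < q $ i" "y \<in> orthant" "y \<noteq> 0"
  shows "0 < q \<bullet> y"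
proof -
  obtain i where "y $ i \<noteq> 0" using assms(3) by (auto simp: vec_eq_iff)
  then have "0 < q $ i * y $ i" using assms(1,2) by (auto simp: orthant_def less_le)
  also have "\<dots> \<le> q \<bullet> y" by (rule component_le_inner[OF assms(1,2)])
  finally show ?thesis .
qed

lemma compact_budget_set:
  fixes q :: "real ^ 'n"
  assumes "\<And>i. 0 < q $ i"
  shows "compact {y \<in> orthant. q \<bullet> y \<le> w}"
proof -
  have "y \<in> cbox 0 (\<chi> i. w / q $ i)" if "y \<in> orthant" "q \<bullet> y \<le> w" for y
  proof -
    have "y $ i \<le> w / q $ i" for i
      using component_le_inner[OF assms that(1), of i] that(2) assms[of i]
      by (simp add: field_simps)
    then show ?thesis using that(1) by (auto simp: mem_box_cart orthant_def)
  qed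
  then have "bounded {y \<in> orthant. q \<bullet> y \<le> w}"
    by (intro bounded_subset[OF bounded_cbox]) auto
  moreover have "closed {y \<in> orthant. q \<bullet> y \<le> w}"
  proof -
    have "{y \<in> orthant. q \<bullet> y \<le> w} = orthant \<inter> {y. q \<bullet> y \<le> w}" by auto
    then show ?thesis
      by (auto intro!: closed_Int closed_orthant closed_Collect_le continuous_intros)
  qed
  ultimately show ?thesis by (simp add: compact_eq_bounded_closed)
qed

section \<open>Demand for a homogeneous utility\<close>

locale homogeneous_utility =
  fixes u :: "real ^ 'n \<Rightarrow> real" and d w :: real and A :: "real ^ 'n ^ 'm"
  assumes w_pos: "0 < w" and d_pos: "0 < d"
    and cont: "continuous_on orthant u"
    and homog: "homogeneous_on orthant d u"
begin

lemma u_scale: "x \<in> orthant \<Longrightarrow> 0 < t \<Longrightarrow> u (t *\<^sub>R x) = t powr d * u x"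
  using homog by (simp add: homogeneous_on_def)

lemma u_zero: "u 0 = 0"
proof -
  have "u 0 = 2 powr d * u 0" using u_scale[OF zero_in_orthant, of 2] by simp
  moreover have "(2::real) powr d \<noteq> 1" using d_pos by simp
  ultimately show ?thesis by simp
qed

lemma log_domainD:
  assumes "y \<in> log_domain u"
  shows "y \<in> orthant" "0 < u y" "y \<noteq> 0"
  using assms u_zero by (auto simp: log_domain_def)

lemma log_domain_scaleR:
  assumes "y \<in> log_domain u" "0 < t"
  shows "t *\<^sub>R y \<in> log_domain u"
  using assms by (simp add: log_domain_def orthant_scaleR u_scale)

lemma ln_u_scale:
  assumes "y \<in> log_domain u" "0 < t"
  shows "ln (u (t *\<^sub>R y)) = d * ln t + ln (u y)"
  using assms log_domainD(2)[OF assms(1)] by (simp add: u_scale log_domainD(1) ln_mult ln_powr)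

lemma inner_pos_log_domain:
  assumes "\<And>i. 0 < q $ i" "y \<in> log_domain u"
  shows "0 < q \<bullet> y"
  using inner_pos[OF assms(1)] log_domainD[OF assms(2)] by blast

lemma best_response_iff:
  "best_response u A w q y \<longleftrightarrow> y \<in> feasible u A w q \<and> (\<forall>z\<in>feasible u A w q. u z \<le> u y)"
  by (auto simp: best_response_def is_arg_max_linorder feasible_def neg_log_def
      log_domain_def Ball_def)

lemma best_responseD:
  assumes "best_response u A w q y"
  shows "y \<in> log_domain u" "y \<in> orthant" "0 < u y" "A *v y = 0" "q \<bullet> y \<le> w"
  using assms log_domainD by (auto simp: best_response_iff feasible_def)

text \<open>Homogeneity removes the budget: rescaling \<open>z\<close> to the budget plane of \<open>q\<close> changes
  \<open>ln (u z)\<close> by \<open>d * ln (w / (q \<bullet> z))\<close>, so a best response maximises the scale-invariant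
  function \<open>ln u - d ln (q \<bullet> _)\<close> over the whole cone of admissible bundles.\<close>

lemma best_response_ray:
  assumes q: "\<And>i. 0 < q $ i" and br: "best_response u A w q y"
    and z: "z \<in> log_domain u" "A *v z = 0"
  shows "ln (u z) - d * ln (q \<bullet> z) \<le> ln (u y) - d * ln w"
proof -
  let ?t = "w / (q \<bullet> z)"
  have qz: "0 < q \<bullet> z" by (rule inner_pos_log_domain[OF q z(1)])
  then have t: "0 < ?t" using w_pos by simp
  have "?t *\<^sub>R z \<in> feasible u A w q"
    using log_domain_scaleR[OF z(1) t] z(2) qz
    by (simp add: feasible_def matrix_vector_mult_scaleR)
  then have "u (?t *\<^sub>R z) \<le> u y" using br by (auto simp: best_response_iff)
  then have "ln (u (?t *\<^sub>R z)) \<le> ln (u y)"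
    using log_domainD[OF log_domain_scaleR[OF z(1) t]] best_responseD[OF br] by simp
  then show ?thesis
    using ln_u_scale[OF z(1) t] qz w_pos by (simp add: ln_div algebra_simps)
qed

text \<open>The tangent line of the concave function \<open>d ln\<close> at \<open>w\<close>. Its slope \<open>d / w\<close> is where
  the multiplier of the budget constraint comes from.\<close>

lemma log_ray_bound:
  fixes t :: real
  assumes "0 < t"
  shows "d * ln t - d * ln w \<le> (d / w) * (t - w)"
  using mult_left_mono[OF ln_diff_le[OF assms w_pos], of d] d_pos by (simp add: algebra_simps)

text \<open>Replacing \<open>d ln (q \<bullet> z)\<close> by its tangent makes the scale-invariant inequality affine in
  the price: a best response also maximises the Lagrangian with multiplier \<open>d / w\<close> on the
  kernel of \<open>A\<close>. This one inequality yields the derivative of the value function, strong duality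
  and the first-order condition.\<close>

lemma best_response_lagrangian:
  assumes q: "\<And>i. 0 < q $ i" and br: "best_response u A w q y"
    and z: "z \<in> log_domain u" "A *v z = 0"
  shows "ln (u z) - (d / w) * (q \<bullet> z - w) \<le> ln (u y)"
  using best_response_ray[OF assms] log_ray_bound[OF inner_pos_log_domain[OF q z(1)]] by simp

lemma best_response_spends_budget:
  assumes q: "\<And>i. 0 < q $ i" and br: "best_response u A w q y"
  shows "q \<bullet> y = w"
proof -
  note y = best_responseD[OF br]
  have "ln w \<le> ln (q \<bullet> y)"
    using best_response_ray[OF q br y(1,4)] d_pos by simp
  then have "w \<le> q \<bullet> y" using w_pos inner_pos_log_domain[OF q y(1)] by simp
  with y(5) show ?thesis by simp
qed

text \<open>The maximum over the compact budget set is positive because some rescaling of \<open>z\<close> lies in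
  that set; hence the maximiser has finite logarithmic utility and is feasible.\<close>

lemma best_response_exists:
  assumes q: "\<And>i. 0 < q $ i" and z: "z \<in> log_domain u" "A *v z = 0"
  shows "\<exists>y. best_response u A w q y"
proof -
  let ?B = "{y \<in> orthant. q \<bullet> y \<le> w} \<inter> {y. A *v y = 0}"
  have "compact ?B"
    by (intro compact_Int_closed compact_budget_set[OF q] closed_Collect_eq continuous_intros)
  moreover have zB: "(w / (q \<bullet> z)) *\<^sub>R z \<in> ?B" "0 < u ((w / (q \<bullet> z)) *\<^sub>R z)"
    using log_domain_scaleR[OF z(1), of "w / (q \<bullet> z)"] inner_pos_log_domain[OF q z(1)] w_pos z
    by (auto simp: log_domain_def matrix_vector_mult_scaleR)
  moreover have "continuous_on ?B u"
    using cont by (rule continuous_on_subset) auto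
  ultimately obtain y where y: "y \<in> ?B" "\<forall>v\<in>?B. u v \<le> u y"
    using continuous_attains_sup[of ?B u] by blast
  then have "0 < u y" using zB by force
  then have "best_response u A w q y"
    using y by (auto simp: best_response_iff feasible_def log_domain_def)
  then show ?thesis by blast
qed

lemma value_fun_eq:
  assumes br: "best_response u A w q y"
  shows "value_fun u A w q = ln (u y)"
  unfolding value_fun_def
proof (rule cSup_eq_maximum)
  show "ln (u y) \<in> (\<lambda>x. - neg_log u x) ` feasible u A w q"
    using br by (auto simp: best_response_iff neg_log_def)
  show "v \<le> ln (u y)" if "v \<in> (\<lambda>x. - neg_log u x) ` feasible u A w q" for v
    using that br by (auto simp: best_response_iff neg_log_def feasible_def log_domain_def)
qed

text \<open>Upper hemicontinuity of demand. Best responses at prices near \<open>p\<close> stay in one compact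
  budget set, and any limit point of them is affordable at \<open>p\<close> and at least as good as \<open>x\<close>,
  since rescalings of \<open>x\<close> compete at every nearby price. Uniqueness at the single price \<open>p\<close>
  therefore controls all best responses at nearby prices, unique or not.\<close>

lemma best_responses_converge:
  assumes p: "\<And>i. 0 < p $ i"
    and x: "best_response u A w p x" and unique: "\<And>y. best_response u A w p y \<Longrightarrow> y = x"
    and \<epsilon>: "0 < \<epsilon>"
  shows "\<forall>\<^sub>F q in nhds p. \<forall>y. best_response u A w q y \<longrightarrow> dist y x < \<epsilon>"
proof (rule ccontr)
  assume neg: "\<not> ?thesis"
  \<comment> \<open>Prices above \<open>p / 2\<close> have budget sets inside the compact budget set of \<open>p / 2\<close>.\<close>
  have half: "\<forall>\<^sub>F q in nhds p. \<forall>i. p $ i / 2 < q $ i"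
  proof (rule eventually_all_finite)
    fix i
    have "p $ i / 2 < p $ i" using p[of i] by simp
    moreover have "((\<lambda>q. q $ i) \<longlongrightarrow> p $ i) (nhds p)"
      by (intro tendsto_intros filterlim_ident)
    ultimately show "\<forall>\<^sub>F q in nhds p. p $ i / 2 < q $ i"
      by (metis order_tendstoD(1))
  qed
  have "\<exists>q y. dist q p < inverse (real (Suc k)) \<and> (\<forall>i. p $ i / 2 < q $ i)
      \<and> best_response u A w q y \<and> \<epsilon> \<le> dist y x" for k
  proof (rule ccontr)
    assume no: "\<not> ?thesis"
    have "\<forall>\<^sub>F q in nhds p. dist q p < inverse (real (Suc k))"
      by (metis eventually_nhds_metric inverse_positive_iff_positive of_nat_0_less_iff zero_less_Suc)
    then have "\<forall>\<^sub>F q in nhds p. \<forall>y. best_response u A w q y \<longrightarrow> dist y x < \<epsilon>"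
      using half by eventually_elim (use no in force)
    with neg show False by blast
  qed
  then obtain Q Y where QY: "\<And>k. dist (Q k) p < inverse (real (Suc k))"
    "\<And>k i. p $ i / 2 < Q k $ i" "\<And>k. best_response u A w (Q k) (Y k)" "\<And>k. \<epsilon> \<le> dist (Y k) x"
    by metis
  have Qlim: "Q \<longlonglongrightarrow> p"
    by (rule metric_tendsto_imp_tendsto[OF LIMSEQ_inverse_real_of_nat])
      (use QY(1) in \<open>auto intro!: always_eventually simp: less_imp_le\<close>)
  have Qpos: "0 < Q k $ i" for k i
    using QY(2)[of i k] p[of i] by simp
  let ?r = "(1/2) *\<^sub>R p"
  have "Y k \<in> {y \<in> orthant. ?r \<bullet> y \<le> w}" for k
  proof -
    have "?r \<bullet> Y k \<le> Q k \<bullet> Y k"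
      using QY(2)[of _ k] best_responseD[OF QY(3)]
      by (intro inner_le_of_price_le) (auto simp: less_imp_le)
    then show ?thesis using best_responseD[OF QY(3)[of k]] by auto
  qed
  moreover have "compact {y \<in> orthant. ?r \<bullet> y \<le> w}"
    using p by (intro compact_budget_set) auto
  ultimately obtain y s where ys: "y \<in> orthant" "strict_mono s" "(Y \<circ> s) \<longlonglongrightarrow> y"
    unfolding compact_def by blast
  note x' = best_responseD[OF x]
  have Qs: "(\<lambda>k. Q (s k)) \<longlonglongrightarrow> p"
    using LIMSEQ_subseq_LIMSEQ[OF Qlim ys(2)] by (simp add: o_def)
  have Ys: "(\<lambda>k. Y (s k)) \<longlonglongrightarrow> y" using ys(3) by (simp add: o_def)
  have py: "p \<bullet> y \<le> w"
    by (rule tendsto_upperbound[OF tendsto_inner[OF Qs Ys]])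
      (use best_responseD[OF QY(3)] in auto)
  have Ay: "A *v y = 0"
  proof (rule LIMSEQ_unique)
    show "(\<lambda>k. A *v Y (s k)) \<longlonglongrightarrow> A *v y"
      by (rule tendsto_compose[OF _ Ys, THEN tendsto_eq_rhs])
        (auto intro: isContD linear_continuous_at matrix_vector_mul_bounded_linear)
    show "(\<lambda>k. A *v Y (s k)) \<longlonglongrightarrow> 0"
      by (simp add: best_responseD(4)[OF QY(3)])
  qed
  have uY: "(\<lambda>k. u (Y (s k))) \<longlonglongrightarrow> u y"
    using cont ys(1) Ys best_responseD(2)[OF QY(3)]
    by (auto simp: continuous_on_sequentially o_def)
  have px: "p \<bullet> x = w" by (rule best_response_spends_budget[OF p x])
  \<comment> \<open>The rescaling of \<open>x\<close> that exhausts the budget at the price \<open>Q (s k)\<close> competes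
    with the best response there.\<close>
  have lower: "(w / (Q (s k) \<bullet> x)) powr d * u x \<le> u (Y (s k))" for k
  proof -
    let ?t = "w / (Q (s k) \<bullet> x)"
    have qx: "0 < Q (s k) \<bullet> x" by (rule inner_pos_log_domain[OF Qpos x'(1)])
    then have t: "0 < ?t" using w_pos by simp
    then have "?t *\<^sub>R x \<in> feasible u A w (Q (s k))"
      using x' qx log_domain_scaleR[OF x'(1) t]
      by (simp add: feasible_def matrix_vector_mult_scaleR)
    then show ?thesis
      using QY(3)[of "s k"] u_scale[OF x'(2) t] by (auto simp: best_response_iff)
  qed
  have "(\<lambda>k. (w / (Q (s k) \<bullet> x)) powr d * u x) \<longlonglongrightarrow> (w / (p \<bullet> x)) powr d * u x"
    using px w_pos Qs by (intro tendsto_intros) auto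
  then have "(w / (p \<bullet> x)) powr d * u x \<le> u y"
    using lower by (intro tendsto_le[OF _ uY]) auto
  then have ux: "u x \<le> u y" using px w_pos by simp
  then have "best_response u A w p y"
    using x x'(3) ys(1) py Ay by (force simp: best_response_iff feasible_def log_domain_def)
  then have "y = x" by (rule unique)
  moreover have "\<epsilon> \<le> dist y x"
    by (rule tendsto_lowerbound[OF tendsto_dist[OF Ys tendsto_const]]) (use QY(4) in auto)
  ultimately show False using \<epsilon> by simp
qed

lemma eventually_prices_pos:
  fixes p :: "real ^ 'n"
  assumes "\<And>i. 0 < p $ i"
  shows "\<forall>\<^sub>F q in nhds p. \<forall>i. 0 < q $ i"
  using eventually_nhds_in_open[of "interior orthant" p] assms
  by (simp add: interior_orthant open_interior[of orthant, unfolded interior_orthant])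

text \<open>An envelope theorem. Comparing a best response \<open>y\<close> at \<open>q\<close> with \<open>x\<close> in both
  directions traps the first-order remainder of the value function between \<open>0\<close> and
  \<open>(d / w) * ((p - q) \<bullet> (y - x))\<close>, and \<open>y\<close> tends to \<open>x\<close>.\<close>

lemma gderiv_value_fun:
  assumes p: "\<And>i. 0 < p $ i"
    and x: "best_response u A w p x" and unique: "\<And>y. best_response u A w p y \<Longrightarrow> y = x"
  shows "GDERIV (value_fun u A w) p :> (- (d / w)) *\<^sub>R x"
  unfolding gderiv_def has_derivative_at_alt
proof (intro conjI allI impI)
  show "bounded_linear (\<lambda>h. h \<bullet> (- (d / w)) *\<^sub>R x)" by (rule bounded_linear_inner_left)
next
  fix e :: real assume e: "0 < e"
  note x' = best_responseD[OF x]
  have px: "p \<bullet> x = w" by (rule best_response_spends_budget[OF p x])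
  have "\<forall>\<^sub>F q in nhds p. norm (value_fun u A w q - value_fun u A w p
      - (q - p) \<bullet> (- (d / w)) *\<^sub>R x) \<le> e * norm (q - p)"
  proof -
    have "0 < e * w / d" using e w_pos d_pos by simp
    then have "\<forall>\<^sub>F q in nhds p. \<forall>y. best_response u A w q y \<longrightarrow> dist y x < e * w / d"
      using best_responses_converge[OF p x _ \<open>0 < e * w / d\<close>] unique by blast
    with eventually_prices_pos[OF p] show ?thesis
    proof eventually_elim
      case (elim q)
      then have q: "\<And>i. 0 < q $ i" by blast
      obtain y where y: "best_response u A w q y"
        using best_response_exists[OF q x'(1,4)] by blast
      note y' = best_responseD[OF y]
      have qy: "q \<bullet> y = w" by (rule best_response_spends_budget[OF q y])
      have close: "norm (y - x) < e * w / d" using elim(2) y by (auto simp: dist_norm)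
      have V: "value_fun u A w q = ln (u y)" "value_fun u A w p = ln (u x)"
        using value_fun_eq x y by auto
      have lower: "0 \<le> ln (u y) - ln (u x) + (d / w) * ((q - p) \<bullet> x)"
        using best_response_lagrangian[OF q y x'(1,4)] px by (simp add: inner_diff_left)
      have "ln (u y) - ln (u x) + (d / w) * ((q - p) \<bullet> x) \<le> (d / w) * ((p - q) \<bullet> (y - x))"
        using best_response_lagrangian[OF p x y'(1,4)] px qy w_pos
        by (simp add: inner_diff_left inner_diff_right algebra_simps)
      also have "\<dots> \<le> (d / w) * (norm (p - q) * norm (y - x))"
        using d_pos w_pos by (intro mult_left_mono norm_cauchy_schwarz) auto
      also have "\<dots> \<le> (d / w) * (norm (p - q) * (e * w / d))"
        using d_pos w_pos close by (intro mult_left_mono) auto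
      also have "\<dots> = e * norm (q - p)"
        using d_pos w_pos by (simp add: norm_minus_commute)
      finally show ?case using lower V by simp
    qed
  qed
  then show "\<exists>r>0. \<forall>q. norm (q - p) < r \<longrightarrow> norm (value_fun u A w q - value_fun u A w p
      - (q - p) \<bullet> (- (d / w)) *\<^sub>R x) \<le> e * norm (q - p)"
    by (simp add: eventually_nhds_metric dist_norm)
qed

end

section \<open>Multipliers for linear constraints\<close>

lemma inner_transpose_vector:
  fixes A :: "real ^ 'n ^ 'm"
  shows "(transpose A *v v) \<bullet> y = v \<bullet> (A *v y)"
  by (simp add: dot_lmul_matrix)

text \<open>Lagrange multipliers for linear equations: the orthogonal projection of \<open>a\<close> onto the range
  of the transpose leaves a remainder in the kernel of \<open>A\<close>, to which \<open>a\<close> is orthogonal.\<close>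

lemma orthogonal_kernel_imp_range_transpose:
  fixes A :: "real ^ 'n ^ 'm"
  assumes orth: "\<And>z. A *v z = 0 \<Longrightarrow> a \<bullet> z = 0"
  shows "\<exists>v. a = transpose A *v v"
proof -
  have sub: "subspace (range ((*v) (transpose A)))"
    by (rule linear_subspace_image[OF matrix_vector_mul_linear subspace_UNIV])
  then have span: "span (range ((*v) (transpose A))) = range ((*v) (transpose A))"
    by (simp add: span_eq_iff)
  obtain y z where yz: "y \<in> range ((*v) (transpose A))"
    "\<And>v. v \<in> range ((*v) (transpose A)) \<Longrightarrow> orthogonal z v" "a = y + z"
    using orthogonal_subspace_decomp_exists[of "range ((*v) (transpose A))" a] unfolding span
    by blast
  have "v \<bullet> (A *v z) = 0" for v
    using yz(2)[of "transpose A *v v"] by (simp only: orthogonal_def inner_commute[of z] inner_transpose_vector) simp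
  then have "A *v z = 0" using inner_eq_zero_iff by blast
  then have "a \<bullet> z = 0" by (rule orth)
  moreover have "y \<bullet> z = 0" using yz(2)[OF yz(1)] by (simp add: orthogonal_def inner_commute)
  ultimately have "z = 0" using yz(3) by (simp add: inner_add_left)
  then show ?thesis using yz(1,3) by auto
qed

lemma linear_bounded_below_on_subspace:
  fixes a :: "'a :: real_inner"
  assumes "subspace S" "\<And>z. z \<in> S \<Longrightarrow> b \<le> a \<bullet> z" "z \<in> S"
  shows "a \<bullet> z = 0"
proof (rule ccontr)
  assume nz: "a \<bullet> z \<noteq> 0"
  have "((b - 1) / (a \<bullet> z)) *\<^sub>R z \<in> S" by (rule subspace_scale[OF assms(1,3)])
  from assms(2)[OF this] nz show False by simp
qed

text \<open>Strong duality for a concave maximisation with linear equality constraints. The strict hypograph of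
  \<open>\<psi>\<close> is separated from the kernel of \<open>A\<close> placed at height \<open>M\<close>. Separating in
  the domain, and not in the image of \<open>A\<close>, allows \<open>A\<close> to have dependent rows: the
  horizontal part of the normal is orthogonal to the kernel and so has the form
  \<open>transpose A *v v\<close>, while the interior point \<open>z\<close> forces the vertical part to be positive.\<close>

lemma kernel_constraint_multiplier:
  fixes A :: "real ^ 'n ^ 'm" and \<psi> :: "real ^ 'n \<Rightarrow> real"
  assumes conc: "concave_on S \<psi>" and z: "z \<in> interior S" "A *v z = 0"
    and max: "\<And>y. y \<in> S \<Longrightarrow> A *v y = 0 \<Longrightarrow> \<psi> y \<le> M"
  shows "\<exists>mu. \<forall>y\<in>S. \<psi> y - mu \<bullet> (A *v y) \<le> M"
proof -
  let ?C = "{(y, r). y \<in> S \<and> r < \<psi> y}"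
  let ?K = "{y. A *v y = 0}"
  have zS: "z \<in> S" using z(1) interior_subset by blast
  have K: "subspace ?K"
    by (auto simp: subspace_def matrix_vector_right_distrib matrix_vector_mult_scaleR)
  have "convex ?C"
    unfolding convex_def
  proof clarsimp
    fix y r y' r' and s t :: real
    assume h: "y \<in> S" "r < \<psi> y" "y' \<in> S" "r' < \<psi> y'" "0 \<le> s" "0 \<le> t" "s + t = 1"
    have "s * r + t * r' < s * \<psi> y + t * \<psi> y'"
    proof (cases "s = 0")
      case True then show ?thesis using h by simp
    next
      case False
      then have "s * r < s * \<psi> y" using h by simp
      moreover have "t * r' \<le> t * \<psi> y'" using h by (simp add: mult_left_mono)
      ultimately show ?thesis by simp
    qed
    also have "\<dots> \<le> \<psi> (s *\<^sub>R y + t *\<^sub>R y')"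
      using h conc unfolding concave_on_iff by blast
    finally show "s *\<^sub>R y + t *\<^sub>R y' \<in> S \<and> s * r + t * r' < \<psi> (s *\<^sub>R y + t *\<^sub>R y')"
      using h conc by (auto simp: concave_on_iff intro: convexD)
  qed
  moreover have "convex (?K \<times> {M})"
    by (rule convex_Times[OF subspace_imp_convex[OF K]]) simp
  moreover have "(z, \<psi> z - 1) \<in> ?C" "(z, M) \<in> ?K \<times> {M}" using zS z(2) by auto
  moreover have "?C \<inter> (?K \<times> {M}) = {}" using max by force
  ultimately obtain e \<beta> where e: "e \<noteq> 0" "\<forall>v\<in>?C. e \<bullet> v \<le> \<beta>" "\<forall>v\<in>?K \<times> {M}. \<beta> \<le> e \<bullet> v"
    using separating_hyperplane_sets[of ?C "?K \<times> {M}"] by blast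
  obtain a c where ac: "e = (a, c)" by (cases e)
  have C: "a \<bullet> y + c * r \<le> \<beta>" if "y \<in> S" "r < \<psi> y" for y r
    using e(2) that by (auto simp: ac inner_Pair)
  have L: "\<beta> - c * M \<le> a \<bullet> y" if "y \<in> ?K" for y
    using e(3) that by (auto simp: ac inner_Pair)
  have orth: "a \<bullet> y = 0" if "y \<in> ?K" for y
    by (rule linear_bounded_below_on_subspace[OF K L that])
  have \<beta>: "\<beta> \<le> c * M" using L[of 0] by simp
  have c: "0 < c"
  proof (rule ccontr)
    assume nc: "\<not> 0 < c"
    show False
    proof (cases "c = 0")
      case False
      then have "c < 0" using nc by simp
      let ?r = "min (\<psi> z - 1) ((\<beta> + 1) / c)"
      have "c * ((\<beta> + 1) / c) \<le> c * ?r"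
        using \<open>c < 0\<close> by (intro mult_left_mono_neg) auto
      moreover have "c * ?r \<le> \<beta>" using C[OF zS, of ?r] orth z(2) by simp
      ultimately show False using \<open>c < 0\<close> by simp
    next
      case True
      obtain \<rho> where \<rho>: "0 < \<rho>" "cball z \<rho> \<subseteq> S"
        using z(1) by (meson mem_interior_cball)
      have "a \<noteq> 0" using e(1) True ac by (auto simp: zero_prod_def)
      let ?y = "z + (\<rho> / norm a) *\<^sub>R a"
      have "?y \<in> S" using \<rho> \<open>a \<noteq> 0\<close> by (intro subsetD[OF \<rho>(2)]) (auto simp: dist_norm)
      then have "a \<bullet> ?y \<le> \<beta>" using C[of ?y "\<psi> ?y - 1"] True by simp
      moreover have "a \<bullet> ?y = \<rho> * norm a"
        using orth z(2) \<open>a \<noteq> 0\<close>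
        by (simp add: inner_add_right dot_square_norm power2_eq_square)
      moreover have "0 < \<rho> * norm a" using \<rho> \<open>a \<noteq> 0\<close> by simp
      ultimately show False using \<beta> True by simp
    qed
  qed
  obtain v where v: "a = transpose A *v v"
    using orthogonal_kernel_imp_range_transpose[of A a] orth by blast
  have "\<psi> y - ((- 1 / c) *\<^sub>R v) \<bullet> (A *v y) \<le> M" if y: "y \<in> S" for y
  proof -
    have "r \<le> M - (a \<bullet> y) / c" if "r < \<psi> y" for r
      using C[OF y that] \<beta> c by (simp add: field_simps)
    then have "\<psi> y \<le> M - (a \<bullet> y) / c" by (rule dense_le)
    then show ?thesis by (simp add: v dot_lmul_matrix)
  qed
  then show ?thesis by blast
qed

section \<open>The dual problem\<close>

context homogeneous_utility
begin

lemma dual_fun_le_iff: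
  "dual_fun u A w p lam mu \<le> ereal c \<longleftrightarrow> (\<forall>y\<in>log_domain u. lagrangian u A w p y lam mu \<le> c)"
  by (simp add: dual_fun_def SUP_le_iff)

lemma lagrangian_le_dual_fun:
  "y \<in> log_domain u \<Longrightarrow> ereal (lagrangian u A w p y lam mu) \<le> dual_fun u A w p lam mu"
  unfolding dual_fun_def by (rule SUP_upper)

text \<open>A factor \<open>s\<close> on both multipliers can be moved into the bundle, \<open>y\<close> becoming \<open>s y\<close>, and
  homogeneity turns that into the explicit correction terms.\<close>

lemma dual_fun_scale:
  assumes s: "0 < s" and c: "dual_fun u A w p lam mu \<le> ereal c"
  shows "dual_fun u A w p (s * lam) (s *\<^sub>R mu) \<le> ereal (c - d * ln s + (s - 1) * (lam * w))"
  unfolding dual_fun_le_iff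
proof
  fix y assume y: "y \<in> log_domain u"
  have "lagrangian u A w p (s *\<^sub>R y) lam mu \<le> c"
    using c log_domain_scaleR[OF y s] by (simp add: dual_fun_le_iff)
  then show "lagrangian u A w p y (s * lam) (s *\<^sub>R mu) \<le> c - d * ln s + (s - 1) * (lam * w)"
    using ln_u_scale[OF y s]
    by (simp add: lagrangian_def neg_log_def matrix_vector_mult_scaleR algebra_simps)
qed

text \<open>With zero multiplier on \<open>A x = 0\<close> the dual function bounds the problem without linear
  constraints, which is the same problem for the zero matrix and so has a solution. Hence the
  dual function is not infinite everywhere, and a dual optimum has a finite value.\<close>

lemma dual_fun_bounded:
  assumes q: "\<And>i. 0 < q $ i" and z: "z \<in> log_domain u"
  shows "\<exists>c. dual_fun u A w q (d / w) 0 \<le> ereal c"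
proof -
  interpret free: homogeneous_utility u d w "0 :: real ^ 'n ^ 'm"
    by unfold_locales
  obtain y where y: "best_response u (0 :: real ^ 'n ^ 'm) w q y"
    using free.best_response_exists[OF q z] by auto
  have "lagrangian u A w q v (d / w) 0 \<le> ln (u y)" if "v \<in> log_domain u" for v
    using free.best_response_lagrangian[OF q y that]
    by (simp add: lagrangian_def neg_log_def algebra_simps)
  then show ?thesis unfolding dual_fun_le_iff by blast
qed

text \<open>At a dual optimum, scaling the multipliers by \<open>s\<close> cannot lower the dual value, so
  \<open>d ln s \<le> (s - 1) lam w\<close> for every \<open>s > 0\<close>. Both sides vanish at \<open>s = 1\<close>,
  hence they are tangent there, which says \<open>d = lam w\<close>.\<close>

lemma dual_optimal_budget_multiplier:
  assumes q: "\<And>i. 0 < q $ i" and z: "z \<in> log_domain u"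
    and opt: "dual_optimal u A w q lam mu"
  shows "lam = d / w"
proof -
  obtain c where "dual_fun u A w q (d / w) 0 \<le> ereal c" using dual_fun_bounded[OF q z] by blast
  moreover have "dual_fun u A w q lam mu \<le> dual_fun u A w q (d / w) 0"
    using opt d_pos w_pos by (simp add: dual_optimal_def)
  ultimately have "dual_fun u A w q lam mu \<le> ereal c" by order
  with lagrangian_le_dual_fun[OF z, of q lam mu] obtain D where D: "dual_fun u A w q lam mu = ereal D"
    by (cases "dual_fun u A w q lam mu") auto
  have lam: "0 \<le> lam" using opt by (simp add: dual_optimal_def)
  have key: "d * ln s \<le> (s - 1) * (lam * w)" if s: "0 < s" for s
  proof -
    have "ereal D \<le> dual_fun u A w q (s * lam) (s *\<^sub>R mu)"
      unfolding D[symmetric] using opt s lam by (simp add: dual_optimal_def)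
    also have "\<dots> \<le> ereal (D - d * ln s + (s - 1) * (lam * w))"
      by (rule dual_fun_scale[OF s]) (simp add: D)
    finally show ?thesis by simp
  qed
  have "lam \<noteq> 0" using key[of 2] mult_pos_pos[OF d_pos ln_gt_zero[of 2]] by auto
  then have r: "0 < lam * w / d" using lam w_pos d_pos by simp
  \<comment> \<open>The scale that would bring the multiplier to \<open>d / w\<close>.\<close>
  have "d * - ln (lam * w / d) \<le> (d / (lam * w) - 1) * (lam * w)"
    using key[of "d / (lam * w)"] r d_pos w_pos \<open>lam \<noteq> 0\<close> lam by (simp add: ln_div)
  also have "\<dots> = d * (1 - lam * w / d)"
    using d_pos w_pos \<open>lam \<noteq> 0\<close> by (simp add: field_simps)
  finally have "- ln (lam * w / d) \<le> 1 - lam * w / d"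
    unfolding mult_le_cancel_left_pos[OF d_pos] .
  then have "lam * w / d = 1"
    using ln_le_minus_one[OF r] ln_eq_minus_one[OF r] by linarith
  then show ?thesis using d_pos w_pos by (simp add: field_simps)
qed

end

section \<open>Consequences of strict concavity\<close>

locale concave_homogeneous_utility = homogeneous_utility u d w A
  for u :: "real ^ 'n \<Rightarrow> real" and d w :: real and A :: "real ^ 'n ^ 'm" +
  assumes sconc: "strictly_concave_on (interior orthant) u"
begin

lemma strictly_concaveD:
  assumes "x \<in> interior orthant" "y \<in> interior orthant" "x \<noteq> y" "0 < t" "t < 1"
  shows "(1 - t) * u x + t * u y < u ((1 - t) *\<^sub>R x + t *\<^sub>R y)"
  using sconc assms unfolding strictly_concave_on_def by blast

text \<open>Continuity carries concavity from the interior to the boundary, approached along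
  \<open>v + inverse (Suc n) * (1, \<dots>, 1)\<close>.\<close>

lemma concave: "concave_on orthant u"
  unfolding concave_on_iff
proof (intro conjI ballI allI impI)
  show "convex (orthant :: (real ^ 'n) set)" by (rule convex_orthant)
  fix x y :: "real ^ 'n" and a b :: real
  assume xy: "x \<in> orthant" "y \<in> orthant" and ab: "0 \<le> a" "0 \<le> b" "a + b = 1"
  let ?e = "\<lambda>n. (\<chi> i. inverse (real (Suc n))) :: real ^ 'n"
  have e: "?e \<longlonglongrightarrow> 0"
    by (rule vec_tendstoI) (simp add: LIMSEQ_inverse_real_of_nat[unfolded of_nat_Suc])
  have int: "v + ?e n \<in> interior orthant" if "v \<in> orthant" for v n
    using that unfolding interior_orthant
    by (auto simp: interior_orthant orthant_def[where 'n = 'n] intro!: add_nonneg_pos)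
  have lim: "(\<lambda>n. u (v + ?e n)) \<longlonglongrightarrow> u v" if "v \<in> orthant" for v
  proof -
    have "(\<lambda>n. v + ?e n) \<longlonglongrightarrow> v" using tendsto_add[OF tendsto_const e, of v] by simp
    moreover have "v + ?e n \<in> orthant" for n
      using int[OF that] interior_subset by blast
    ultimately show ?thesis
      by (intro continuous_on_tendsto_compose[OF cont _ that]) auto
  qed
  have "a * u (x + ?e n) + b * u (y + ?e n) \<le> u (a *\<^sub>R x + b *\<^sub>R y + ?e n)" for n
  proof (cases "x = y \<or> a = 0 \<or> b = 0")
    case True
    then show ?thesis using ab by (auto simp flip: scaleR_add_left distrib_right)
  next
    case False
    then have "x + ?e n \<noteq> y + ?e n" "0 < b" "b < 1" "a = 1 - b" using ab by auto
    then have "a * u (x + ?e n) + b * u (y + ?e n) < u (a *\<^sub>R (x + ?e n) + b *\<^sub>R (y + ?e n))"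
      using strictly_concaveD[OF int[OF xy(1)] int[OF xy(2)]] by blast
    moreover have "a *\<^sub>R (x + ?e n) + b *\<^sub>R (y + ?e n) = a *\<^sub>R x + b *\<^sub>R y + ?e n"
    proof -
      have "a *\<^sub>R ?e n + b *\<^sub>R ?e n = ?e n" using ab(3) by (simp flip: scaleR_add_left)
      then show ?thesis by (simp add: scaleR_add_right algebra_simps)
    qed
    ultimately show ?thesis by simp
  qed
  moreover have "a *\<^sub>R x + b *\<^sub>R y \<in> orthant"
    using convex_orthant xy ab by (auto simp: convex_def)
  ultimately show "a * u x + b * u y \<le> u (a *\<^sub>R x + b *\<^sub>R y)"
    using lim xy by (intro tendsto_le[OF _ lim tendsto_add[OF tendsto_mult[OF tendsto_const lim] tendsto_mult[OF tendsto_const lim]]]) auto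
qed

text \<open>A sign argument on rays. Concavity between \<open>0\<close> and \<open>2 v\<close> gives
  \<open>2 powr d / 2 * u v \<le> u v\<close>. Positivity of \<open>u x\<close> then forces \<open>d \<le> 1\<close>, whereas
  a negative value in the interior forces \<open>d \<ge> 1\<close>; but for \<open>d = 1\<close>, or for the value
  \<open>0\<close>, the utility is linear along an interior ray and not strictly concave.\<close>

lemma interior_subset_log_domain:
  assumes x: "x \<in> log_domain u"
  shows "interior orthant \<subseteq> log_domain u"
proof
  fix z :: "real ^ 'n" assume z: "z \<in> interior orthant"
  have half: "2 powr d / 2 * u v \<le> u v" if v: "v \<in> orthant" for v
  proof -
    have "(1/2) * u 0 + (1/2) * u (2 *\<^sub>R v) \<le> u ((1/2) *\<^sub>R 0 + (1/2) *\<^sub>R (2 *\<^sub>R v))"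
      by (intro concave[unfolded concave_on_iff, THEN conjunct2, rule_format])
        (use zero_in_orthant orthant_scaleR[OF v, of 2] in auto)
    then show ?thesis using u_scale[OF v, of 2] u_zero by simp
  qed
  have zo: "z \<in> orthant" using z interior_subset by blast
  have "0 < u z"
  proof (rule ccontr)
    assume "\<not> 0 < u z"
    then have nonpos: "u z \<le> 0" by simp
    have le: "2 powr d \<le> 2" using half[of x] log_domainD[OF x] by simp
    have z2: "2 *\<^sub>R z \<in> interior orthant" "z \<noteq> 2 *\<^sub>R z"
      and z3: "3 *\<^sub>R z \<in> interior orthant" "z \<noteq> 3 *\<^sub>R z"
      using z by (auto simp: interior_orthant vec_eq_iff less_le)
    have "(1 - 1/2) * u z + (1/2) * u (3 *\<^sub>R z) < u ((1 - 1/2) *\<^sub>R z + (1/2) *\<^sub>R (3 *\<^sub>R z))"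
      by (rule strictly_concaveD) (use z z3 in auto)
    moreover have "(1 - 1/2) *\<^sub>R z + (1/2) *\<^sub>R (3 *\<^sub>R z) = 2 *\<^sub>R z"
      by (simp flip: scaleR_add_left)
    ultimately have strict: "u z / 2 + 3 powr d * u z / 2 < 2 powr d * u z"
      using u_scale[OF zo, of 2] u_scale[OF zo, of 3] by simp
    then have neg: "u z < 0" using nonpos by (cases "u z = 0") auto
    then have "2 \<le> 2 powr d" using half[OF zo] by (simp add: field_simps)
    then have "(2::real) powr d = 2 powr 1" using le by simp
    then have "d = 1" by (subst (asm) powr_inj) auto
    with strict show False by simp
  qed
  then show "z \<in> log_domain u" using zo by (simp add: log_domain_def)
qed

end

section \<open>Inverting a matrix on the kernel of the constraints\<close>

lemma matrix_inv_inverse: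
  fixes M :: "real ^ 'k ^ 'k"
  assumes "invertible M"
  shows "M ** matrix_inv M = mat 1" and "matrix_inv M ** M = mat 1"
proof -
  have "\<exists>N. M ** N = mat 1 \<and> N ** M = mat 1" using assms by (simp add: invertible_def)
  then have "M ** matrix_inv M = mat 1 \<and> matrix_inv M ** M = mat 1"
    unfolding matrix_inv_def by (rule someI_ex)
  then show "M ** matrix_inv M = mat 1" "matrix_inv M ** M = mat 1" by auto
qed

text \<open>The top left block of the inverse of the bordered matrix with rows \<open>(W, transpose A)\<close> and
  \<open>(A, 0)\<close>. The next two lemmas characterise it as the map that vanishes on the range of
  \<open>transpose A\<close> and inverts \<open>W\<close> on the kernel of \<open>A\<close>.\<close>

definition kernel_inverse :: "real ^ 'n ^ 'n \<Rightarrow> real ^ 'n ^ 'm \<Rightarrow> real ^ 'n ^ 'n" where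
  "kernel_inverse W A = matrix_inv W - matrix_inv W ** transpose A **
     matrix_inv (A ** matrix_inv W ** transpose A) ** A ** matrix_inv W"

lemma kernel_inverse_transpose:
  fixes A :: "real ^ 'n ^ 'm"
  assumes "invertible (A ** matrix_inv W ** transpose A)"
  shows "kernel_inverse W A *v (transpose A *v v) = 0"
proof -
  let ?V = "matrix_inv W" and ?M = "A ** matrix_inv W ** transpose A"
  have M: "matrix_inv ?M *v (A *v (?V *v (transpose A *v v))) = v"
  proof -
    have "A *v (?V *v (transpose A *v v)) = ?M *v v"
      by (simp only: matrix_vector_mul_assoc matrix_mul_assoc)
    moreover have "matrix_inv ?M *v (?M *v v) = v"
      by (simp only: matrix_vector_mul_assoc[of "matrix_inv ?M"] matrix_inv_inverse[OF assms]
          matrix_vector_mul_lid)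
    ultimately show ?thesis by (simp only:)
  qed
  have "kernel_inverse W A *v (transpose A *v v) = ?V *v (transpose A *v v) - ?V *v
      (transpose A *v (matrix_inv ?M *v (A *v (?V *v (transpose A *v v)))))"
    by (simp only: kernel_inverse_def matrix_vector_mult_diff_rdistrib
        matrix_vector_mul_assoc[symmetric])
  then show ?thesis by (simp only: M) simp
qed

lemma kernel_inverse_kernel:
  fixes A :: "real ^ 'n ^ 'm"
  assumes W: "invertible W" and y: "A *v y = 0"
  shows "kernel_inverse W A *v (W *v y) = y"
proof -
  have V: "matrix_inv W *v (W *v y) = y"
    by (simp add: matrix_vector_mul_assoc matrix_inv_inverse[OF W])
  have "kernel_inverse W A *v (W *v y) = matrix_inv W *v (W *v y) - matrix_inv W *v
      (transpose A *v (matrix_inv (A ** matrix_inv W ** transpose A) *v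
        (A *v (matrix_inv W *v (W *v y)))))"
    by (simp only: kernel_inverse_def matrix_vector_mult_diff_rdistrib
        matrix_vector_mul_assoc[symmetric])
  then show ?thesis by (simp only: V y) simp
qed

text \<open>A pointwise implicit function theorem. The gradient \<open>G\<close> is only differentiable at the single
  point \<open>X p\<close>, so the usual version for continuously differentiable maps does not apply; instead
  continuity of \<open>X\<close> at \<open>p\<close> is given. The identity \<open>eq\<close> first shows that \<open>X\<close> is
  Lipschitz at \<open>p\<close>, and the Lipschitz bound turns the remainder of \<open>G\<close> into a remainder
  of order \<open>o(norm (q - p))\<close>.\<close>

lemma has_derivative_implicit:
  fixes X :: "'a :: real_normed_vector \<Rightarrow> 'b :: real_normed_vector"
    and G :: "'b \<Rightarrow> 'a"
  assumes G: "(G has_derivative G') (at (X p))"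
    and X: "(X \<longlongrightarrow> X p) (nhds p)"
    and T: "bounded_linear T" and c: "0 < c"
    and eq: "\<forall>\<^sub>F q in nhds p. X q - X p
        = - c *\<^sub>R T (q - p) - T (G (X q) - G (X p) - G' (X q - X p))"
  shows "(X has_derivative (\<lambda>h. - c *\<^sub>R T h)) (at p)"
  unfolding has_derivative_at_alt
proof (intro conjI allI impI)
  show "bounded_linear (\<lambda>h. - c *\<^sub>R T h)"
    by (rule bounded_linear_compose[OF bounded_linear_scaleR_right T])
next
  fix e :: real assume e: "0 < e"
  obtain K where K: "0 < K" "\<And>v. norm (T v) \<le> norm v * K"
    using bounded_linear.pos_bounded[OF T] by blast
  \<comment> \<open>The first bound absorbs half of \<open>X q - X p\<close>, the second makes the final remainder at most
    \<open>e * norm (q - p)\<close>.\<close>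
  define \<eta> where "\<eta> = min (1 / (2 * K)) (e / (2 * c * K\<^sup>2))"
  have \<eta>: "0 < \<eta>" using K c e by (simp add: \<eta>_def)
  have \<eta>1: "\<eta> * K \<le> 1 / 2"
    using mult_right_mono[of \<eta> "1 / (2 * K)" K] K by (simp add: \<eta>_def)
  have \<eta>2: "\<eta> * K * (2 * c * K) \<le> e"
  proof -
    have "\<eta> * (2 * c * K\<^sup>2) \<le> e / (2 * c * K\<^sup>2) * (2 * c * K\<^sup>2)"
      using K c by (intro mult_right_mono) (auto simp: \<eta>_def)
    then show ?thesis using K c by (simp add: power2_eq_square algebra_simps)
  qed
  obtain r where r: "0 < r"
    "\<And>y. norm (y - X p) < r \<Longrightarrow> norm (G y - G (X p) - G' (y - X p)) \<le> \<eta> * norm (y - X p)"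
    using G \<eta> unfolding has_derivative_at_alt by blast
  have "\<forall>\<^sub>F q in nhds p. norm (X q - X p) < r"
    using tendstoD[OF X r(1)] by (simp add: dist_norm)
  then have "\<forall>\<^sub>F q in nhds p. norm (X q - X p - - c *\<^sub>R T (q - p)) \<le> e * norm (q - p)"
    using eq
  proof eventually_elim
    case (elim q)
    let ?R = "G (X q) - G (X p) - G' (X q - X p)"
    have R: "norm (T ?R) \<le> \<eta> * K * norm (X q - X p)"
    proof -
      have "norm (T ?R) \<le> norm ?R * K" by (rule K(2))
      also have "\<dots> \<le> \<eta> * norm (X q - X p) * K"
        using r(2)[OF elim(1)] K(1) by (intro mult_right_mono) auto
      finally show ?thesis by (simp add: algebra_simps)
    qed
    have "norm (X q - X p) = norm (- (c *\<^sub>R T (q - p) + T ?R))"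
      by (subst elim(2)) simp
    also have "\<dots> = norm (c *\<^sub>R T (q - p) + T ?R)" by (rule norm_minus_cancel)
    also have "\<dots> \<le> c * norm (T (q - p)) + norm (T ?R)"
      using norm_triangle_ineq[of "c *\<^sub>R T (q - p)" "T ?R"] c by simp
    also have "\<dots> \<le> c * (norm (q - p) * K) + 1 / 2 * norm (X q - X p)"
      using R mult_right_mono[OF \<eta>1, of "norm (X q - X p)"] K(2)[of "q - p"] c
      by (intro add_mono mult_left_mono) auto
    finally have lip: "norm (X q - X p) \<le> 2 * c * K * norm (q - p)" by (simp add: algebra_simps)
    have "X q - X p - - c *\<^sub>R T (q - p) = - T ?R"
      by (subst elim(2)) simp
    then have "norm (X q - X p - - c *\<^sub>R T (q - p)) = norm (T ?R)" by simp
    also have "\<dots> \<le> \<eta> * K * (2 * c * K * norm (q - p))"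
      using \<eta> K(1) by (intro order.trans[OF R] mult_left_mono[OF lip]) simp
    also have "\<dots> \<le> e * norm (q - p)"
      using mult_right_mono[OF \<eta>2, of "norm (q - p)"] by (simp add: mult.assoc)
    finally show ?case .
  qed
  then show "\<exists>r>0. \<forall>q. norm (q - p) < r \<longrightarrow> norm (X q - X p - - c *\<^sub>R T (q - p)) \<le> e * norm (q - p)"
    by (simp add: eventually_nhds_metric dist_norm)
qed

section \<open>Strong duality, the first-order condition and the Hessian\<close>

context concave_homogeneous_utility
begin

lemma concave_ln_u: "concave_on (log_domain u) (\<lambda>y. ln (u y))"
  unfolding concave_on_iff
proof (intro conjI ballI allI impI)
  have comb: "a *\<^sub>R x + b *\<^sub>R y \<in> log_domain u \<and> 0 < a * u x + b * u y
      \<and> a * u x + b * u y \<le> u (a *\<^sub>R x + b *\<^sub>R y)"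
    if "x \<in> log_domain u" "y \<in> log_domain u" "0 \<le> a" "0 \<le> b" "a + b = 1" for x y a b
  proof -
    have "a * u x + b * u y \<le> u (a *\<^sub>R x + b *\<^sub>R y)"
      using concave that unfolding concave_on_iff log_domain_def by blast
    moreover have "0 < a * u x + b * u y"
      using that log_domainD(2)[OF that(1)] log_domainD(2)[OF that(2)]
      by (cases "a = 0") (simp_all add: add_pos_nonneg)
    moreover have "a *\<^sub>R x + b *\<^sub>R y \<in> orthant"
      using convexD[OF convex_orthant] that log_domainD by blast
    ultimately show ?thesis by (simp add: log_domain_def)
  qed
  then show "convex (log_domain u)" by (simp add: convex_def)
  fix x y and a b :: real
  assume xy: "x \<in> log_domain u" "y \<in> log_domain u" and ab: "0 \<le> a" "0 \<le> b" "a + b = 1"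
  have "a * ln (u x) + b * ln (u y) \<le> ln (a * u x + b * u y)"
    using ln_concave ab log_domainD(2)[OF xy(1)] log_domainD(2)[OF xy(2)]
    unfolding concave_on_iff by auto
  also have "\<dots> \<le> ln (u (a *\<^sub>R x + b *\<^sub>R y))"
    using comb[OF xy ab] by simp
  finally show "a * ln (u x) + b * ln (u y) \<le> ln (u (a *\<^sub>R x + b *\<^sub>R y))" .
qed

text \<open>The objective penalised by the budget multiplier \<open>d / w\<close> is concave and is maximised over the
  kernel of \<open>A\<close> at the best response, so a multiplier for the kernel constraint closes the duality
  gap.\<close>

lemma dual_optimal_exists:
  assumes q: "\<And>i. 0 < q $ i" and x: "best_response u A w q x"
    and z: "z \<in> interior orthant" "A *v z = 0"
  shows "\<exists>mu. dual_optimal u A w q (d / w) mu"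
proof -
  note x' = best_responseD[OF x]
  let ?\<psi> = "\<lambda>y. ln (u y) - (d / w) * (q \<bullet> y - w)"
  have "concave_on (log_domain u) ?\<psi>"
    unfolding concave_on_iff
  proof (intro conjI ballI allI impI)
    show "convex (log_domain u)" using concave_ln_u by (simp add: concave_on_iff)
    fix y y' and a b :: real
    assume h: "y \<in> log_domain u" "y' \<in> log_domain u" "0 \<le> a" "0 \<le> b" "a + b = 1"
    have "a * ln (u y) + b * ln (u y') \<le> ln (u (a *\<^sub>R y + b *\<^sub>R y'))"
      using concave_ln_u h unfolding concave_on_iff by blast
    moreover have "a * (q \<bullet> y - w) + b * (q \<bullet> y' - w)
        = q \<bullet> (a *\<^sub>R y + b *\<^sub>R y') - (a + b) * w"
      by (simp add: inner_add_right algebra_simps)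
    moreover have "a * ?\<psi> y + b * ?\<psi> y' = a * ln (u y) + b * ln (u y')
        - (d / w) * (a * (q \<bullet> y - w) + b * (q \<bullet> y' - w))"
      by (simp add: algebra_simps add_divide_distrib diff_divide_distrib)
    ultimately show "a * ?\<psi> y + b * ?\<psi> y' \<le> ?\<psi> (a *\<^sub>R y + b *\<^sub>R y')"
      by (simp only: h(5) mult_1 diff_right_mono)
  qed
  moreover have "z \<in> interior (log_domain u)"
    using z(1) interior_maximal[OF interior_subset_log_domain[OF x'(1)] open_interior] by blast
  ultimately obtain mu where mu: "\<forall>y\<in>log_domain u. ?\<psi> y - mu \<bullet> (A *v y) \<le> ln (u x)"
    using kernel_constraint_multiplier[OF _ _ z(2), of "log_domain u" ?\<psi> "ln (u x)"]
      best_response_lagrangian[OF q x] by blast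
  have "dual_fun u A w q (d / w) mu \<le> ereal (ln (u x))"
    using mu by (simp add: dual_fun_le_iff lagrangian_def neg_log_def algebra_simps)
  moreover have "ereal (ln (u x)) \<le> dual_fun u A w q lam' mu'" if "0 \<le> lam'" for lam' mu'
    using lagrangian_le_dual_fun[OF x'(1), of q lam' mu'] x'(4)
      best_response_spends_budget[OF q x] by (simp add: lagrangian_def neg_log_def)
  ultimately have "dual_optimal u A w q (d / w) mu"
    using d_pos w_pos unfolding dual_optimal_def by (meson divide_nonneg_pos less_imp_le order.trans)
  then show ?thesis by blast
qed

lemma best_response_unique_interior:
  assumes y: "best_response u A w q y" "y \<in> interior orthant"
    and y': "best_response u A w q y'" "y' \<in> interior orthant"
  shows "y' = y"
proof (rule ccontr)
  assume "y' \<noteq> y"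
  let ?m = "(1 - 1/2) *\<^sub>R y' + (1/2) *\<^sub>R y"
  have eq: "u y' = u y"
    using y(1) y'(1) by (force simp: best_response_iff)
  have "u y < u ?m"
    using strictly_concaveD[OF y'(2) y(2) \<open>y' \<noteq> y\<close>, of "1/2"] eq by simp
  moreover have "?m \<in> feasible u A w q"
  proof -
    have "?m \<in> orthant"
      by (rule convexD[OF convex_orthant best_responseD(2)[OF y'(1)] best_responseD(2)[OF y(1)]]) auto
    moreover have "0 < u ?m" using \<open>u y < u ?m\<close> best_responseD(3)[OF y(1)] by simp
    moreover have "A *v ?m = 0"
      using best_responseD(4)[OF y(1)] best_responseD(4)[OF y'(1)]
      by (simp add: matrix_vector_right_distrib matrix_vector_mult_scaleR)
    moreover have "q \<bullet> ?m \<le> w"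
      using best_responseD(5)[OF y(1)] best_responseD(5)[OF y'(1)] by (simp add: inner_add_right)
    ultimately show ?thesis by (simp add: feasible_def log_domain_def)
  qed
  ultimately show False using y(1) by (force simp: best_response_iff)
qed

text \<open>Along a kernel direction an interior best response is a local minimum of
  \<open>neg_log u + (d / w) (q \<bullet> _)\<close>, with the multiplier already known.\<close>

lemma best_response_stationary:
  assumes q: "\<And>i. 0 < q $ i" and y: "best_response u A w q y" "y \<in> interior orthant"
    and g: "GDERIV (neg_log u) y :> g" and z: "A *v z = 0"
  shows "(g + (d / w) *\<^sub>R q) \<bullet> z = 0"
proof -
  note y' = best_responseD[OF y(1)]
  let ?F = "\<lambda>v. neg_log u v + (d / w) * (q \<bullet> v)"
  have "(?F has_derivative (\<lambda>h. h \<bullet> g + (d / w) * (q \<bullet> h))) (at (y + 0 *\<^sub>R z))"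
    using g unfolding gderiv_def by (intro derivative_intros) auto
  moreover have "((\<lambda>t. y + t *\<^sub>R z) has_derivative (\<lambda>t. t *\<^sub>R z)) (at 0)"
    by (auto intro!: derivative_eq_intros)
  ultimately have "((\<lambda>t. ?F (y + t *\<^sub>R z)) has_derivative
      (\<lambda>t. (t *\<^sub>R z) \<bullet> g + (d / w) * (q \<bullet> (t *\<^sub>R z)))) (at 0)"
    using has_derivative_compose by blast
  then have D: "DERIV (\<lambda>t. ?F (y + t *\<^sub>R z)) 0 :> (g + (d / w) *\<^sub>R q) \<bullet> z"
    unfolding has_field_derivative_def
    by (rule has_derivative_eq_rhs) (auto simp: fun_eq_iff inner_add_left inner_commute algebra_simps)
  have "((\<lambda>t. y + t *\<^sub>R z) \<longlongrightarrow> y + 0 *\<^sub>R z) (nhds 0)"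
    by (intro tendsto_intros filterlim_ident)
  then have "\<forall>\<^sub>F t in nhds 0. y + t *\<^sub>R z \<in> interior orthant"
    using y(2) by (intro topological_tendstoD) auto
  then obtain r where r: "0 < r" "\<And>t. \<bar>t\<bar> < r \<Longrightarrow> y + t *\<^sub>R z \<in> interior orthant"
    by (auto simp: eventually_nhds_metric)
  have min: "?F (y + 0 *\<^sub>R z) \<le> ?F (y + t *\<^sub>R z)" if t: "\<bar>0 - t\<bar> < r" for t
  proof -
    have "y + t *\<^sub>R z \<in> log_domain u"
      using r(2)[of t] t interior_subset_log_domain[OF y'(1)] by auto
    then have "ln (u (y + t *\<^sub>R z)) - (d / w) * (q \<bullet> (y + t *\<^sub>R z) - w) \<le> ln (u y)"
      using y'(4) z by (intro best_response_lagrangian[OF q y(1)])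
        (simp_all add: matrix_vector_right_distrib matrix_vector_mult_scaleR)
    then show ?thesis using best_response_spends_budget[OF q y(1)]
      by (simp add: neg_log_def right_diff_distrib)
  qed
  show ?thesis
    by (rule DERIV_local_min[OF D r(1)]) (use min in blast)
qed

text \<open>Near \<open>p\<close> all best responses lie close to \<open>x\<close>, hence in the interior, where strict
  concavity makes them unique. So the gradient formula holds on a neighbourhood and the Hessian is
  \<open>- d / w\<close> times the derivative of demand \<open>X\<close>. Applying the kernel inverse to the
  first-order condition removes the unknown multiplier of \<open>A x = 0\<close> and leaves the implicit
  equation for \<open>X\<close>.\<close>

lemma hessian_value_fun:
  assumes p: "\<And>i. 0 < p $ i"
    and x: "best_response u A w p x" and unique: "\<And>y. best_response u A w p y \<Longrightarrow> y = x"
    and int: "x \<in> interior orthant" and H: "has_hessian (neg_log u) W x"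
    and W: "invertible W" and M: "invertible (A ** matrix_inv W ** transpose A)"
  shows "has_hessian (value_fun u A w) ((d\<^sup>2 / w\<^sup>2) *\<^sub>R kernel_inverse W A) p"
proof -
  let ?T = "kernel_inverse W A"
  note x' = best_responseD[OF x]
  obtain G where G: "\<forall>\<^sub>F y in nhds x. GDERIV (neg_log u) y :> G y"
    "(G has_derivative (\<lambda>h. W *v h)) (at x)"
    using H by (auto simp: has_hessian_def)
  have "\<forall>\<^sub>F y in nhds x. y \<in> interior orthant" using int by (intro eventually_nhds_in_open) auto
  with G(1) obtain r where r: "0 < r"
    "\<And>y. dist y x < r \<Longrightarrow> y \<in> interior orthant \<and> GDERIV (neg_log u) y :> G y"
    by (metis (mono_tags, lifting) eventually_conj eventually_nhds_metric)
  define X where "X q = (SOME y. best_response u A w q y)" for q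
  have X: "best_response u A w q (X q)" if "\<And>i. 0 < q $ i" for q
    unfolding X_def by (rule someI_ex) (rule best_response_exists[OF that x'(1,4)])
  have Xp: "X p = x" using unique X[OF p] by blast
  have conv: "\<forall>\<^sub>F q in nhds p. \<forall>y. best_response u A w q y \<longrightarrow> dist y x < \<epsilon>" if "0 < \<epsilon>" for \<epsilon>
    using best_responses_converge[OF p x _ that] unique by blast
  have pos: "\<forall>\<^sub>F q in nhds p. \<forall>i. 0 < q $ i" by (rule eventually_prices_pos[OF p])
  have lim: "(X \<longlongrightarrow> X p) (nhds p)"
  proof (rule tendstoI)
    fix \<epsilon> :: real assume "0 < \<epsilon>"
    from conv[OF this] pos show "\<forall>\<^sub>F q in nhds p. dist (X q) (X p) < \<epsilon>"
      by eventually_elim (use X Xp in auto)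
  qed
  have stat: "?T *v (G (X q) + (d / w) *\<^sub>R q) = 0"
    if q: "\<And>i. 0 < q $ i" and near: "dist (X q) x < r" for q
  proof -
    have "(G (X q) + (d / w) *\<^sub>R q) \<bullet> z = 0" if "A *v z = 0" for z
      using best_response_stationary[OF q X[OF q] _ _ that] r(2)[OF near] by blast
    then obtain v where "G (X q) + (d / w) *\<^sub>R q = transpose A *v v"
      using orthogonal_kernel_imp_range_transpose by blast
    then show ?thesis by (simp only: kernel_inverse_transpose[OF M])
  qed
  have eq: "\<forall>\<^sub>F q in nhds p. X q - X p
      = - (d / w) *\<^sub>R (?T *v (q - p)) - ?T *v (G (X q) - G (X p) - W *v (X q - X p))"
    using conv[OF r(1)] pos
  proof eventually_elim
    case (elim q)
    then have q: "\<And>i. 0 < q $ i" and near: "dist (X q) x < r" using X by auto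
    have "A *v (X q - X p) = 0"
      using best_responseD(4)[OF X[OF q]] best_responseD(4)[OF X[OF p]]
      by (simp add: matrix_vector_mult_diff_distrib)
    then have TW: "?T *v (W *v (X q - X p)) = X q - X p" by (rule kernel_inverse_kernel[OF W])
    have "?T *v (G (X q) - G (X p) - W *v (X q - X p))
        = ?T *v G (X q) - ?T *v G (X p) - (X q - X p)"
      by (simp only: matrix_vector_mult_diff_distrib[of ?T] TW)
    moreover have "?T *v G (X q) - ?T *v G (X p) = - (d / w) *\<^sub>R (?T *v (q - p))"
    proof -
      have "?T *v (G (X q) + (d / w) *\<^sub>R q) = ?T *v (G (X p) + (d / w) *\<^sub>R p)"
        using stat[OF q near] stat[OF p] r(1) Xp by simp
      then show ?thesis
        by (simp add: matrix_vector_mult_diff_distrib matrix_vector_right_distrib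
            matrix_vector_mult_scaleR algebra_simps)
    qed
    ultimately show ?case by simp
  qed
  have "bounded_linear ((*v) ?T)" by simp
  then have dX: "(X has_derivative (\<lambda>h. - (d / w) *\<^sub>R (?T *v h))) (at p)"
    using G(2) Xp lim eq d_pos w_pos by (intro has_derivative_implicit[where G = G]) auto
  have "\<forall>\<^sub>F q in nhds p. GDERIV (value_fun u A w) q :> (- (d / w)) *\<^sub>R X q"
    using conv[OF r(1)] pos
  proof eventually_elim
    case (elim q)
    then have q: "\<And>i. 0 < q $ i" by blast
    have "y = X q" if y: "best_response u A w q y" for y
      using elim(1) r(2) X[OF q] y best_response_unique_interior by blast
    then show ?case by (rule gderiv_value_fun[OF q X[OF q]])
  qed
  moreover have "((\<lambda>q. (- (d / w)) *\<^sub>R X q) has_derivative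
      (\<lambda>h. ((d\<^sup>2 / w\<^sup>2) *\<^sub>R ?T) *v h)) (at p)"
    by (rule has_derivative_eq_rhs[OF has_derivative_scaleR_right[OF dX]])
      (simp add: fun_eq_iff power2_eq_square scaleR_matrix_vector_assoc)
  ultimately show ?thesis
    unfolding has_hessian_def by (intro exI[of _ "\<lambda>q. (- (d / w)) *\<^sub>R X q"] conjI)
qed

end

section \<open>Multiplier, gradient and Hessian of the value function\<close>

theorem theorem6p2:
  fixes u :: "real ^ 'n \<Rightarrow> real" and d w :: real and A :: "real ^ 'n ^ 'm"
    and P :: "(real ^ 'n) set" and x :: "real ^ 'n \<Rightarrow> real ^ 'n" and p :: "real ^ 'n"
  assumes "0 < w" and "0 < d"
    and "\<And>q i. q \<in> P \<Longrightarrow> 0 < q $ i"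
    and "continuous_on orthant u"
    and "homogeneous_on orthant d u"
    and "u differentiable_on interior orthant"
    and "strictly_concave_on (interior orthant) u"
    and "\<And>q y. q \<in> P \<Longrightarrow> best_response u A w q y \<longleftrightarrow> y = x q"
    and "p \<in> P"
  shows "(\<forall>lam mu. dual_optimal u A w p lam mu \<longrightarrow> lam = d / w)
    \<and> ((\<exists>z \<in> interior orthant. A *v z = 0) \<longrightarrow> (\<exists>mu. dual_optimal u A w p (d / w) mu))
    \<and> GDERIV (value_fun u A w) p :> (- (d / w)) *\<^sub>R x p
    \<and> (\<forall>W. x p \<in> interior orthant \<longrightarrow> has_hessian (neg_log u) W (x p) \<longrightarrow>
          invertible W \<longrightarrow> invertible (A ** matrix_inv W ** transpose A) \<longrightarrow>
          has_hessian (value_fun u A w)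
            ((d\<^sup>2 / w\<^sup>2) *\<^sub>R
              (matrix_inv W - matrix_inv W ** transpose A **
                 matrix_inv (A ** matrix_inv W ** transpose A) ** A ** matrix_inv W)) p)"
proof -
  interpret concave_homogeneous_utility u d w A
    by unfold_locales (fact assms)+
  have p: "\<And>i. 0 < p $ i" by (rule assms(3)[OF assms(9)])
  have x: "best_response u A w p (x p)"
    and unique: "\<And>y. best_response u A w p y \<Longrightarrow> y = x p"
    using assms(8)[OF assms(9)] by auto
  show ?thesis
  proof (intro conjI allI impI)
    show "lam = d / w" if "dual_optimal u A w p lam mu" for lam mu
      using p best_responseD(1)[OF x] that by (rule dual_optimal_budget_multiplier)
    show "\<exists>mu. dual_optimal u A w p (d / w) mu" if "\<exists>z\<in>interior orthant. A *v z = 0"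
      using that dual_optimal_exists[OF p x] by blast
    show "GDERIV (value_fun u A w) p :> (- (d / w)) *\<^sub>R x p"
      using p x unique by (rule gderiv_value_fun)
  next
    fix W
    assume "x p \<in> interior orthant" "has_hessian (neg_log u) W (x p)" "invertible W"
      "invertible (A ** matrix_inv W ** transpose A)"
    from hessian_value_fun[OF p x unique this]
    show "has_hessian (value_fun u A w) ((d\<^sup>2 / w\<^sup>2) *\<^sub>R
        (matrix_inv W - matrix_inv W ** transpose A **
           matrix_inv (A ** matrix_inv W ** transpose A) ** A ** matrix_inv W)) p"
      by (simp only: kernel_inverse_def)
  qed
qed

end
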